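(* Let $\mu,\nu,\lambda$ be polynomial dominant weights of $GL_n$ and let $H\in\mathcal{H}(\mu,\nu,\lambda)$, with derived $t$-arrays $T_1(H)$ and $T_2(H)$. Then: (1) $H$ is a hive if and only if the dual array $(T_1(H))^*$ belongs to $GZ(\mu^*,\lambda^*-\nu^*,\nu^* )$; (2) $H$ is a hive if and only if $T_2(H)$ belongs to $GZ(\nu,\lambda-\mu,\mu)$.
   Context: A polynomial dominant weight of $GL_n$ is a sequence of nonnegative integers $\lambda=(\lambda_1,\dots,\lambda_n)$ with $\lambda_1\ge\dots\ge\lambda_n$; its dual is $\lambda^*=(-\lambda_n,-\lambda_{n-1},\dots,-\lambda_1)$. Differences such as $\lambda-\mu$ are componentwise. A $t$-array is an integer array $T=(t^{(i)}_j)_{1\le j\le i\le n}$; its $k$-th row is $(t^{(k)}_1,\dots,t^{(k)}_k)$, its type is its $n$-th row, and its weight is $(w_1,\dots,w_n)$ with $w_1=t^{(1)}_1$ and $w_i=\sum_{k=1}^i t^{(i)}_k-\sum_{k=1}^{i-1}t^{(i-1)}_k$ for $i\ge2$. Its dual array is $T^*=(s^{(i)}_j)$ with $s^{(i)}_j=-t^{(i)}_{i+1-j}$. $T$ is a GT pattern if $t^{(i+1)}_j\ge t^{(i)}_j$ (IC(1)) and $t^{(i)}_j\ge t^{(i+1)}_{j+1}$ (IC(2)) for all $1\le j\le i\le n-1$. The exponents of $T$ are $\varepsilon^{(i)}_j(T)=\sum_{1\le h<j}(t^{(i+1)}_h-2t^{(i)}_h+t^{(i-1)}_h)+(t^{(i+1)}_j-t^{(i)}_j)$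 for $1\le j\le i\le n-1$. For weakly decreasing $\alpha,\gamma\in\mathbb{Z}^n$ and $\beta\in\mathbb{Z}^n$, $GZ(\alpha,\beta,\gamma)$ is the set of GT patterns $T$ of type $\alpha$ and weight $\beta$ with $\varepsilon^{(i)}_j(T)\le\gamma_i-\gamma_{i+1}$ for all $1\le j\le i\le n-1$. An $h$-array is an array of nonnegative integers $H=(h_{a,b})_{0\le a\le b\le n}$ with $h_{0,0}=0$; $\mathcal{H}(\mu,\nu,\lambda)$ is the set of $h$-arrays with $h_{0,i}=\mu_1+\dots+\mu_i$, $h_{i,n}=\sum_{j=1}^n\mu_j+\nu_1+\dots+\nu_i$, $h_{i,i}=\lambda_1+\dots+\lambda_i$ for $1\le i\le n$. $H$ is a hive if RC(1): $h_{a,b}+h_{a-1,b-1}\ge h_{a-1,b}+h_{a,b-1}$ for $1\le a<b\le n$; RC(2): $h_{a-1,b}+h_{a,b}\ge h_{a,b+1}+h_{a-1,b-1}$ for $1\le a\le b<n$; RC(3): $h_{a,b}+h_{a,b+1}\ge h_{a+1,b+1}+h_{a-1,b}$ for $1\le a\le b<n$. The derived $t$-arrays $T_1(H)=(x^{(i)}_j)$, $T_2(H)=(y^{(i)}_j)$ are defined, for $0\le a\le b\le n-1$, by $x^{(n-a)}_{b+1-a}=h_{a,b+1}-h_{a,b}$ and $y^{(b+1)}_{a+1}=h_{a+1,b+1}-h_{a,b+1}$. *)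

theory Defs
  imports Main
begin

text \<open>
  Sequences and arrays are functions on natural-number indices, with the index conventions of the
  mathematics: a sequence \<open>(\<alpha>\<^sub>1, \<dots>, \<alpha>\<^sub>n)\<close> lives on \<open>1 \<le> i \<le> n\<close>; a \<open>t\<close>-array entry \<open>t\<^sup>(\<^sup>i\<^sup>)\<^sub>j\<close> is
  \<open>T i j\<close> for \<open>1 \<le> j \<le> i \<le> n\<close>; an \<open>h\<close>-array entry \<open>h\<^sub>a\<^sub>,\<^sub>b\<close> is \<open>H a b\<close> for \<open>0 \<le> a \<le> b \<le> n\<close>.
  Values outside these ranges are irrelevant, and no predicate below inspects them.
  The weight usually called \<open>lambda\<close> is written \<open>\<kappa>\<close>.
\<close>

type_synonym weight = "nat \<Rightarrow> int"
type_synonym t_array = "nat \<Rightarrow> nat \<Rightarrow> int"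

definition polynomial_dominant :: "nat \<Rightarrow> weight \<Rightarrow> bool" where
  "polynomial_dominant n \<alpha> \<longleftrightarrow>
     (\<forall>i\<in>{1..n}. 0 \<le> \<alpha> i) \<and> (\<forall>i. 1 \<le> i \<and> i < n \<longrightarrow> \<alpha> (i + 1) \<le> \<alpha> i)"

definition dual_weight :: "nat \<Rightarrow> weight \<Rightarrow> weight" where
  "dual_weight n \<alpha> i = - \<alpha> (n + 1 - i)"

definition dual_array :: "t_array \<Rightarrow> t_array" where
  "dual_array T i j = - T i (i + 1 - j)"

text \<open>For \<open>i = 1\<close> the second sum is empty, so the value is \<open>T 1 1\<close>.\<close>
definition array_weight :: "t_array \<Rightarrow> weight" where
  "array_weight T i = (\<Sum>k=1..i. T i k) - (\<Sum>k=1..i - 1. T (i - 1) k)"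

definition GT_pattern :: "nat \<Rightarrow> t_array \<Rightarrow> bool" where
  "GT_pattern n T \<longleftrightarrow>
     (\<forall>i j. 1 \<le> j \<and> j \<le> i \<and> i \<le> n - 1 \<longrightarrow> T (i + 1) j \<ge> T i j) \<and>
     (\<forall>i j. 1 \<le> j \<and> j \<le> i \<and> i \<le> n - 1 \<longrightarrow> T i j \<ge> T (i + 1) (j + 1))"

text \<open>In the sum \<open>h < j \<le> i\<close>, so \<open>T (i - 1) h\<close> is always an entry of row \<open>i - 1 \<ge> 1\<close>.\<close>
definition exponent :: "t_array \<Rightarrow> nat \<Rightarrow> nat \<Rightarrow> int" where
  "exponent T i j =
     (\<Sum>h\<in>{1..<j}. T (i + 1) h - 2 * T i h + T (i - 1) h) + (T (i + 1) j - T i j)"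

text \<open>Intended for \<open>\<alpha>\<close> and \<open>\<gamma>\<close> weakly decreasing on \<open>1..n\<close>.\<close>
definition GZ :: "nat \<Rightarrow> weight \<Rightarrow> weight \<Rightarrow> weight \<Rightarrow> t_array set" where
  "GZ n \<alpha> \<beta> \<gamma> = {T. GT_pattern n T \<and>
     (\<forall>j\<in>{1..n}. T n j = \<alpha> j) \<and>
     (\<forall>i\<in>{1..n}. array_weight T i = \<beta> i) \<and>
     (\<forall>i j. 1 \<le> j \<and> j \<le> i \<and> i \<le> n - 1 \<longrightarrow> exponent T i j \<le> \<gamma> i - \<gamma> (i + 1))}"

definition h_array :: "nat \<Rightarrow> (nat \<Rightarrow> nat \<Rightarrow> int) \<Rightarrow> bool" where
  "h_array n H \<longleftrightarrow> (\<forall>a b. a \<le> b \<and> b \<le> n \<longrightarrow> 0 \<le> H a b) \<and> H 0 0 = 0"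

definition h_arrays :: "nat \<Rightarrow> weight \<Rightarrow> weight \<Rightarrow> weight \<Rightarrow> (nat \<Rightarrow> nat \<Rightarrow> int) set" where
  "h_arrays n \<mu> \<nu> \<kappa> = {H. h_array n H \<and>
     (\<forall>i\<in>{1..n}.
        H 0 i = (\<Sum>j=1..i. \<mu> j) \<and>
        H i n = (\<Sum>j=1..n. \<mu> j) + (\<Sum>j=1..i. \<nu> j) \<and>
        H i i = (\<Sum>j=1..i. \<kappa> j))}"

definition hive :: "nat \<Rightarrow> (nat \<Rightarrow> nat \<Rightarrow> int) \<Rightarrow> bool" where
  "hive n H \<longleftrightarrow> h_array n H \<and>
     (\<forall>a b. 1 \<le> a \<and> a < b \<and> b \<le> n \<longrightarrow>
        H a b + H (a - 1) (b - 1) \<ge> H (a - 1) b + H a (b - 1)) \<and>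
     (\<forall>a b. 1 \<le> a \<and> a \<le> b \<and> b < n \<longrightarrow>
        H (a - 1) b + H a b \<ge> H a (b + 1) + H (a - 1) (b - 1)) \<and>
     (\<forall>a b. 1 \<le> a \<and> a \<le> b \<and> b < n \<longrightarrow>
        H a b + H a (b + 1) \<ge> H (a + 1) (b + 1) + H (a - 1) b)"

text \<open>
  The derived arrays, solved for the entry at \<open>(i, j)\<close>; \<open>derived1_entry\<close> and \<open>derived2_entry\<close> give
  the parametrization by \<open>0 \<le> a \<le> b \<le> n - 1\<close>, where \<open>(n - a, b + 1 - a)\<close> respectively
  \<open>(b + 1, a + 1)\<close> runs through all \<open>(i, j)\<close> with \<open>1 \<le> j \<le> i \<le> n\<close>.
\<close>
definition derived1 :: "nat \<Rightarrow> (nat \<Rightarrow> nat \<Rightarrow> int) \<Rightarrow> t_array" where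
  "derived1 n H i j = H (n - i) (n - i + j) - H (n - i) (n - i + j - 1)"

definition derived2 :: "(nat \<Rightarrow> nat \<Rightarrow> int) \<Rightarrow> t_array" where
  "derived2 H i j = H j i - H (j - 1) i"

lemma derived1_entry:
  assumes "a \<le> b" "b < n"
  shows "derived1 n H (n - a) (b + 1 - a) = H a (b + 1) - H a b"
  using assms by (simp add: derived1_def)

lemma derived2_entry:
  "derived2 H (b + 1) (a + 1) = H (a + 1) (b + 1) - H a (b + 1)"
  by (simp add: derived2_def)

end

theory Submission
  imports Defs
begin

text \<open>
  If \<open>T\<close> consists of the differences \<open>T i j = K j i - K (j - 1) i\<close> of an array \<open>K\<close>, then the two
  interlacing conditions on \<open>T\<close> are the rhombus conditions RC(1) and RC(3) on \<open>K\<close>, and the sum in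
  the exponent telescopes, so that the bound on the exponents becomes RC(2). This applies to
  \<open>T\<^sub>2(H)\<close> with \<open>K = H\<close>, and to \<open>T\<^sub>1(H)\<^sup>*\<close> with the reflected array \<open>K a b = H (n - b) (n - a)\<close>; the
  reflection preserves RC(1) and exchanges RC(2) and RC(3).
\<close>

text \<open>Separated from \<open>h_array\<close> because the conditions are also applied to the
  reflection of \<open>H\<close>, whose value at \<open>0 0\<close> is \<open>H n n\<close> and need
  not vanish.\<close>

definition rhombus_conditions :: "nat \<Rightarrow> (nat \<Rightarrow> nat \<Rightarrow> int) \<Rightarrow> bool" where
  "rhombus_conditions n K \<longleftrightarrow>
     (\<forall>a b. 1 \<le> a \<and> a < b \<and> b \<le> n \<longrightarrow>
        K a b + K (a - 1) (b - 1) \<ge> K (a - 1) b + K a (b - 1)) \<and>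
     (\<forall>a b. 1 \<le> a \<and> a \<le> b \<and> b < n \<longrightarrow>
        K (a - 1) b + K a b \<ge> K a (b + 1) + K (a - 1) (b - 1)) \<and>
     (\<forall>a b. 1 \<le> a \<and> a \<le> b \<and> b < n \<longrightarrow>
        K a b + K a (b + 1) \<ge> K (a + 1) (b + 1) + K (a - 1) b)"

lemma hive_iff_rhombus_conditions:
  "hive n H \<longleftrightarrow> h_array n H \<and> rhombus_conditions n H"
  by (simp add: hive_def rhombus_conditions_def)

lemma rhombus_conditions_reflect_imp:
  assumes "rhombus_conditions n K"
  shows "rhombus_conditions n (\<lambda>a b. K (n - b) (n - a))"
proof -
  have R1: "K (a - 1) b + K a (b - 1) \<le> K a b + K (a - 1) (b - 1)"
    if "1 \<le> a" "a < b" "b \<le> n" for a b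
    using assms that by (auto simp: rhombus_conditions_def)
  have R2: "K a (b + 1) + K (a - 1) (b - 1) \<le> K (a - 1) b + K a b"
    if "1 \<le> a" "a \<le> b" "b < n" for a b
    using assms that by (auto simp: rhombus_conditions_def)
  have R3: "K (a + 1) (b + 1) + K (a - 1) b \<le> K a b + K a (b + 1)"
    if "1 \<le> a" "a \<le> b" "b < n" for a b
    using assms that by (auto simp: rhombus_conditions_def)
  show ?thesis
    unfolding rhombus_conditions_def
  proof (intro conjI allI impI; elim conjE)
    fix a b assume ab: "1 \<le> a" "a < b" "b \<le> n"
    then have "n - (b - 1) = n - b + 1" "n - (a - 1) = n - a + 1"
      "n - b < n - a" "n - a + 1 \<le> n"
      by auto
    then show "K (n - b) (n - (a - 1)) + K (n - (b - 1)) (n - a)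
        \<le> K (n - b) (n - a) + K (n - (b - 1)) (n - (a - 1))"
      \<comment> \<open>Reflection reverses the order of indices, so the largest corner (a, b) of
        the RC(1) rhombus becomes the smallest corner of its image; hence the shift by one, absent
        from the other two cases.\<close>
      using R1[of "n - b + 1" "n - a + 1"] ab by simp
  next
    fix a b assume ab: "1 \<le> a" "a \<le> b" "b < n"
    then have "n - (b - 1) = n - b + 1" "n - (a - 1) = n - a + 1" "n - (b + 1) = n - b - 1"
      "1 \<le> n - b" "n - b \<le> n - a" "n - a < n"
      by auto
    then show "K (n - (b + 1)) (n - a) + K (n - (b - 1)) (n - (a - 1))
        \<le> K (n - b) (n - (a - 1)) + K (n - b) (n - a)"
      using R3[of "n - b" "n - a"] ab by simp
  next
    fix a b assume ab: "1 \<le> a" "a \<le> b" "b < n"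
    then have "n - (a + 1) = n - a - 1" "n - (a - 1) = n - a + 1" "n - (b + 1) = n - b - 1"
      "1 \<le> n - b" "n - b \<le> n - a" "n - a < n"
      by auto
    then show "K (n - (b + 1)) (n - (a + 1)) + K (n - b) (n - (a - 1))
        \<le> K (n - b) (n - a) + K (n - (b + 1)) (n - a)"
      using R2[of "n - b" "n - a"] ab by simp
  qed
qed

text \<open>All corners of the rhombi lie in the triangle a \<le> b \<le> n.\<close>

lemma rhombus_conditions_cong:
  assumes "\<And>a b. a \<le> b \<Longrightarrow> b \<le> n \<Longrightarrow> K a b = L a b"
  shows "rhombus_conditions n K \<longleftrightarrow> rhombus_conditions n L"
  unfolding rhombus_conditions_def
  by (intro conj_cong all_cong1 imp_cong refl; elim conjE; simp add: assms diff_le_mono le_diff_conv)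

text \<open>Reflection is an involution, so one implication suffices. Since subtraction is
  truncated, reflecting twice restores \<open>K\<close> only on the triangle, which is why the
  congruence lemma enters.\<close>

lemma rhombus_conditions_reflect:
  "rhombus_conditions n (\<lambda>a b. K (n - b) (n - a)) \<longleftrightarrow> rhombus_conditions n K"
proof
  assume "rhombus_conditions n (\<lambda>a b. K (n - b) (n - a))"
  from rhombus_conditions_reflect_imp[OF this] show "rhombus_conditions n K"
    by (rule iffD1[OF rhombus_conditions_cong, rotated]) simp
qed (rule rhombus_conditions_reflect_imp)

lemma sum_diff_consecutive_columns:
  fixes T :: t_array
  assumes "\<And>k. 1 \<le> k \<Longrightarrow> k \<le> m \<Longrightarrow> T i k = K k i - K (k - 1) i"
  shows "(\<Sum>k=1..m. T i k) = K m i - K 0 i"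
  using assms by (induction m) auto

text \<open>Each of the three rows in the sum telescopes separately. The boundary terms at column
  index 0 form a second difference of the left edge, which becomes \<gamma> i - \<gamma> (i + 1);
  what remains is the defect of RC(2) at (j, i).\<close>

lemma exponent_differences:
  assumes T: "\<And>i j. 1 \<le> j \<Longrightarrow> j \<le> i \<Longrightarrow> i \<le> n \<Longrightarrow> T i j = K j i - K (j - 1) i"
    and ij: "1 \<le> j" "j \<le> i" "i < n"
  shows "exponent T i j =
    (K 0 i - K 0 (i - 1)) - (K 0 (i + 1) - K 0 i)
    + (K j (i + 1) + K (j - 1) (i - 1)) - (K (j - 1) i + K j i)"
proof -
  have *: "{1..<j} = {1..j - 1}" using ij by auto
  have row: "(\<Sum>h=1..j - 1. T r h) = K (j - 1) r - K 0 r" if "j - 1 \<le> r" "r \<le> n" for r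
    by (rule sum_diff_consecutive_columns) (use T that in auto)
  have "(\<Sum>h=1..j - 1. T (i + 1) h - 2 * T i h + T (i - 1) h) =
      (K (j - 1) (i + 1) - K 0 (i + 1)) - 2 * (K (j - 1) i - K 0 i)
      + (K (j - 1) (i - 1) - K 0 (i - 1))"
    using row[of "i + 1"] row[of i] row[of "i - 1"] ij
    by (simp add: sum.distrib sum_subtractf flip: sum_distrib_left)
  then show ?thesis
    unfolding exponent_def * using T[of j "i + 1"] T[of j i] ij by simp
qed

lemma array_weight_differences:
  assumes T: "\<And>i j. 1 \<le> j \<Longrightarrow> j \<le> i \<Longrightarrow> i \<le> n \<Longrightarrow> T i j = K j i - K (j - 1) i"
    and i: "i \<le> n"
  shows "array_weight T i = (K i i - K (i - 1) (i - 1)) - (K 0 i - K 0 (i - 1))"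
proof -
  have row: "(\<Sum>h=1..r. T r h) = K r r - K 0 r" if "r \<le> n" for r
    by (rule sum_diff_consecutive_columns) (use T that in auto)
  show ?thesis
    unfolding array_weight_def using row[of i] row[of "i - 1"] i by simp
qed

text \<open>Type and weight are forced by the three edges of \<open>K\<close>, so membership comes
  down to the inequalities: IC(1), IC(2) and the exponent bound at (i, j) are RC(1) at (j, i + 1),
  RC(3) at (j, i) and RC(2) at (j, i).\<close>

lemma GZ_differences_iff:
  assumes T: "\<And>i j. 1 \<le> j \<Longrightarrow> j \<le> i \<Longrightarrow> i \<le> n \<Longrightarrow> T i j = K j i - K (j - 1) i"
    and \<gamma>: "\<And>i. 1 \<le> i \<Longrightarrow> i \<le> n \<Longrightarrow> K 0 i - K 0 (i - 1) = \<gamma> i"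
    and \<alpha>: "\<And>i. 1 \<le> i \<Longrightarrow> i \<le> n \<Longrightarrow> K i n - K (i - 1) n = \<alpha> i"
    and \<delta>: "\<And>i. 1 \<le> i \<Longrightarrow> i \<le> n \<Longrightarrow> K i i - K (i - 1) (i - 1) = \<delta> i"
  shows "T \<in> GZ n \<alpha> (\<delta> - \<gamma>) \<gamma> \<longleftrightarrow> rhombus_conditions n K"
proof -
  have type: "\<forall>j\<in>{1..n}. T n j = \<alpha> j"
    using T \<alpha> by simp
  have weight: "\<forall>i\<in>{1..n}. array_weight T i = (\<delta> - \<gamma>) i"
    using array_weight_differences[where T = T and K = K, OF T] \<gamma> \<delta> by simp
  have ic1: "T (i + 1) j \<ge> T i j \<longleftrightarrow>
      K j (i + 1) + K (j - 1) i \<ge> K (j - 1) (i + 1) + K j i"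
    and ic2: "T i j \<ge> T (i + 1) (j + 1) \<longleftrightarrow>
      K j i + K j (i + 1) \<ge> K (j + 1) (i + 1) + K (j - 1) i"
    if "1 \<le> j" "j \<le> i" "i < n" for i j
    using T[of j i] T[of j "i + 1"] T[of "j + 1" "i + 1"] that by auto
  have ex: "exponent T i j \<le> \<gamma> i - \<gamma> (i + 1) \<longleftrightarrow>
      K (j - 1) i + K j i \<ge> K j (i + 1) + K (j - 1) (i - 1)"
    if "1 \<le> j" "j \<le> i" "i < n" for i j
    using exponent_differences[where T = T and K = K, OF T that] \<gamma>[of i] \<gamma>[of "i + 1"] that by auto
  have bound: "1 \<le> j \<and> j \<le> i \<and> i \<le> n - 1 \<longleftrightarrow> 1 \<le> j \<and> j \<le> i \<and> i < n" for i j
    by auto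
  \<comment> \<open>The substitution b = i + 1 brings the index range of RC(1) to that of the
    interlacing conditions.\<close>
  have shift: "(\<forall>a b. 1 \<le> a \<and> a < b \<and> b \<le> n \<longrightarrow> P a b) \<longleftrightarrow>
      (\<forall>i j. 1 \<le> j \<and> j \<le> i \<and> i < n \<longrightarrow> P j (i + 1))" for P :: "nat \<Rightarrow> nat \<Rightarrow> bool"
  proof (intro iffI allI impI)
    fix a b assume P: "\<forall>i j. 1 \<le> j \<and> j \<le> i \<and> i < n \<longrightarrow> P j (i + 1)"
      and "1 \<le> a \<and> a < b \<and> b \<le> n"
    then show "P a b" using P[rule_format, of a "b - 1"] by (cases b) auto
  qed auto
  show ?thesis
    unfolding GZ_def GT_pattern_def rhombus_conditions_def mem_Collect_eq bound shift
    using type weight ic1 ic2 ex by auto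
qed

theorem theorem3p2:
  fixes n :: nat and \<mu> \<nu> \<kappa> :: weight and H :: "nat \<Rightarrow> nat \<Rightarrow> int"
  assumes "n \<ge> 1"
    and "polynomial_dominant n \<mu>" and "polynomial_dominant n \<nu>" and "polynomial_dominant n \<kappa>"
    and "H \<in> h_arrays n \<mu> \<nu> \<kappa>"
  shows "(hive n H \<longleftrightarrow> dual_array (derived1 n H)
            \<in> GZ n (dual_weight n \<mu>) (dual_weight n \<kappa> - dual_weight n \<nu>) (dual_weight n \<nu>)) \<and>
         (hive n H \<longleftrightarrow> derived2 H \<in> GZ n \<nu> (\<kappa> - \<mu>) \<mu>)"
proof -
  have h: "h_array n H" using assms by (simp add: h_arrays_def)
  then have "H 0 0 = 0" by (simp add: h_array_def)
  \<comment> \<open>The edge formulas are extended to i = 0, so that differences can be taken at i =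
    1. For \<open>top\<close> this is the corner \<open>H 0 n\<close>, known from the \<mu> edge
    because n \<ge> 1.\<close>
  then have left: "H 0 i = (\<Sum>j=1..i. \<mu> j)"
    and top: "H i n = (\<Sum>j=1..n. \<mu> j) + (\<Sum>j=1..i. \<nu> j)"
    and diag: "H i i = (\<Sum>j=1..i. \<kappa> j)" if "i \<le> n" for i
    using assms that by (cases "i = 0"; auto simp: h_arrays_def)+
  have split: "(\<Sum>j=1..i. f j) = (\<Sum>j=1..i - 1. f j) + f i" if "1 \<le> i" for i and f :: weight
    using that by (cases i) auto
  have left': "H 0 i - H 0 (i - 1) = \<mu> i"
    and top': "H i n - H (i - 1) n = \<nu> i"
    and diag': "H i i - H (i - 1) (i - 1) = \<kappa> i" if "1 \<le> i" "i \<le> n" for i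
    using left[of i] left[of "i - 1"] top[of i] top[of "i - 1"] diag[of i] diag[of "i - 1"]
      split[OF that(1), of \<mu>] split[OF that(1), of \<nu>] split[OF that(1), of \<kappa>] that
    by linarith+
  \<comment> \<open>The reflection swaps the \<mu> and \<nu> edges and maps the diagonal to itself,
    traversing each edge backwards. Edge differences are thus negated and reversed, which gives the
    dual weights; dualizing \<open>derived1\<close> makes the same change of sign and order within
    each row.\<close>
  define K where "K a b = H (n - b) (n - a)" for a b
  have pred: "n + 1 - i - 1 = n - i" "n - (i - 1) = n + 1 - i" if "1 \<le> i" "i \<le> n" for i
    using that by auto
  have "dual_array (derived1 n H) \<in>
      GZ n (dual_weight n \<mu>) (dual_weight n \<kappa> - dual_weight n \<nu>) (dual_weight n \<nu>)
      \<longleftrightarrow> rhombus_conditions n K"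
  proof (rule GZ_differences_iff)
    fix i j assume ij: "1 \<le> j" "j \<le> i" "i \<le> n"
    then have "n - i + (i + 1 - j) = n + 1 - j" "n + 1 - j - 1 = n - j" "n - (j - 1) = n + 1 - j"
      by auto
    then show "dual_array (derived1 n H) i j = K j i - K (j - 1) i"
      by (simp add: dual_array_def derived1_def K_def)
  next
    fix i assume i: "1 \<le> i" "i \<le> n"
    then have i': "1 \<le> n + 1 - i" "n + 1 - i \<le> n" by auto
    show "K 0 i - K 0 (i - 1) = dual_weight n \<nu> i"
      using top'[OF i'] unfolding K_def dual_weight_def pred[OF i] by simp
    show "K i n - K (i - 1) n = dual_weight n \<mu> i"
      using left'[OF i'] unfolding K_def dual_weight_def pred[OF i] by simp
    show "K i i - K (i - 1) (i - 1) = dual_weight n \<kappa> i"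
      using diag'[OF i'] unfolding K_def dual_weight_def pred[OF i] by simp
  qed
  moreover have "rhombus_conditions n K \<longleftrightarrow> rhombus_conditions n H"
    unfolding K_def by (rule rhombus_conditions_reflect)
  moreover have "derived2 H \<in> GZ n \<nu> (\<kappa> - \<mu>) \<mu> \<longleftrightarrow> rhombus_conditions n H"
    by (rule GZ_differences_iff) (simp_all only: derived2_def left' top' diag')
  ultimately show ?thesis
    using h by (simp add: hive_iff_rhombus_conditions)
qed

end
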